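(* Let $T:\mathbb{R}^n\to\mathbb{R}^n$ be a monotone additively homogeneous map. Then an eigenvector $u$ of $T$ is not unique, up to an additive constant, if and only if there exists a pair $(I,J)$ of nonempty disjoint subsets of $[n]$ such that $\operatorname{reach}(I^c,\mathcal{H}_u^+(T))=I^c$ and $\operatorname{reach}(J^c,\mathcal{H}_u^-(T))=J^c$.
   Context: $[n]=\{1,\dots,n\}$, $K^c=[n]\setminus K$, $e$ is the all-ones vector of $\mathbb{R}^n$, and $e_K$ is the vector with entries $1$ on $K\subset[n]$ and $0$ elsewhere. $T:\mathbb{R}^n\to\mathbb{R}^n$ is monotone if $x\le y\Rightarrow T(x)\le T(y)$ (componentwise order) and additively homogeneous if $T(x+\alpha e)=T(x)+\alpha e$ for all $\alpha\in\mathbb{R}$, $x\in\mathbb{R}^n$. An eigenvector of $T$ is $u\in\mathbb{R}^n$ with $T(u)=\lambda e+u$ for some $\lambda\in\mathbb{R}$. It is unique up to an additive constant if every eigenvector is of the form $u+c\,e$, $c\in\mathbb{R}$. A directed hypergraph $\mathcal{H}=(N,A)$ has a set of nodes $N$ and a set $A$ of hyperarcs, each an ordered pair $(\mathbf{t},\mathbf{h})$ (tail, head) of disjoint nonempty subsets of $N$. Reachability is defined recursively: $j$ is reachable from $I\subset N$ if $j\in I$ or there is a hyperarc $(\mathbf{t},\mathbf{h})$ with $j\in\mathbf{h}$ and every node of $\mathbf{t}$ reachable from $I$. $\operatorname{reach}(I,\mathcal{H})$ is the set of nodes reachable from $I$. $\mathcal{H}_u^+(T)$ and $\mathcal{H}_u^-(T)$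 have node set $[n]$. The hyperarcs of $\mathcal{H}_u^+(T)$ (resp. $\mathcal{H}_u^-(T)$) are the pairs $(J,\{i\})$ with $i\notin J$ and $T_i(u+\varepsilon e_J)>T_i(u)$ for all $\varepsilon>0$ (resp. $T_i(u-\varepsilon e_J)<T_i(u)$ for all $\varepsilon>0$). *)

theory Defs
  imports "HOL-Analysis.Analysis"
begin

text \<open>
  The index set \<open>[n]\<close> is the finite type \<open>'n\<close>, so that complements in \<open>[n]\<close> are complements
  in the type, \<open>\<real>\<^sup>n\<close> is \<^typ>\<open>real ^ 'n\<close>, and the order on \<^typ>\<open>real ^ 'n\<close> is the
  componentwise one; monotone maps are expressed with \<^const>\<open>mono\<close>.
\<close>

definition ind_vec :: "'n set \<Rightarrow> real ^ 'n" where
  "ind_vec K = (\<chi> i. if i \<in> K then 1 else 0)"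

definition all_ones :: "real ^ 'n" where
  "all_ones = (\<chi> i. 1)"

definition additively_homogeneous :: "(real ^ 'n \<Rightarrow> real ^ 'n) \<Rightarrow> bool" where
  "additively_homogeneous T \<longleftrightarrow>
     (\<forall>\<alpha> x. T (x + \<alpha> *\<^sub>R all_ones) = T x + \<alpha> *\<^sub>R all_ones)"

definition add_eigenvector :: "(real ^ 'n \<Rightarrow> real ^ 'n) \<Rightarrow> real ^ 'n \<Rightarrow> bool" where
  "add_eigenvector T u \<longleftrightarrow> (\<exists>l. T u = l *\<^sub>R all_ones + u)"

definition unique_up_to_constant :: "(real ^ 'n \<Rightarrow> real ^ 'n) \<Rightarrow> real ^ 'n \<Rightarrow> bool" where
  "unique_up_to_constant T u \<longleftrightarrow>
     (\<forall>v. add_eigenvector T v \<longrightarrow> (\<exists>c. v = u + c *\<^sub>R all_ones))"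

record 'a hypergraph =
  nodes :: "'a set"
  hyperarcs :: "('a set \<times> 'a set) set"

definition directed_hypergraph :: "'a hypergraph \<Rightarrow> bool" where
  "directed_hypergraph H \<longleftrightarrow>
     (\<forall>(t, h) \<in> hyperarcs H.
        t \<subseteq> nodes H \<and> h \<subseteq> nodes H \<and> t \<noteq> {} \<and> h \<noteq> {} \<and> t \<inter> h = {})"

inductive_set reach :: "'a set \<Rightarrow> 'a hypergraph \<Rightarrow> 'a set"
  for I :: "'a set" and H :: "'a hypergraph" where
  start: "j \<in> I \<Longrightarrow> j \<in> reach I H"
| step: "(t, h) \<in> hyperarcs H \<Longrightarrow> j \<in> h \<Longrightarrow> (\<And>k. k \<in> t \<Longrightarrow> k \<in> reach I H) \<Longrightarrow> j \<in> reach I H"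

definition hypergraph_plus :: "(real ^ 'n \<Rightarrow> real ^ 'n) \<Rightarrow> real ^ 'n \<Rightarrow> 'n hypergraph" where
  "hypergraph_plus T u =
     \<lparr>nodes = UNIV,
      hyperarcs = {(J, {i}) | J i. i \<notin> J \<and> (\<forall>\<epsilon>>0. T (u + \<epsilon> *\<^sub>R ind_vec J) $ i > T u $ i)}\<rparr>"

definition hypergraph_minus :: "(real ^ 'n \<Rightarrow> real ^ 'n) \<Rightarrow> real ^ 'n \<Rightarrow> 'n hypergraph" where
  "hypergraph_minus T u =
     \<lparr>nodes = UNIV,
      hyperarcs = {(J, {i}) | J i. i \<notin> J \<and> (\<forall>\<epsilon>>0. T (u - \<epsilon> *\<^sub>R ind_vec J) $ i < T u $ i)}\<rparr>"

text \<open>Tails are automatically nonempty, since \<^term>\<open>ind_vec {}\<close> is the zero vector.\<close>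

lemma ind_vec_empty: "ind_vec {} = 0"
  by (simp add: ind_vec_def vec_eq_iff)

lemma directed_hypergraph_plus: "directed_hypergraph (hypergraph_plus T u)"
  by (auto simp: directed_hypergraph_def hypergraph_plus_def ind_vec_empty dest: spec[of _ 1])

lemma directed_hypergraph_minus: "directed_hypergraph (hypergraph_minus T u)"
  by (auto simp: directed_hypergraph_def hypergraph_minus_def ind_vec_empty dest: spec[of _ 1])

end

theory Submission
  imports Defs
begin

text \<open>
  Write \<open>e\<close> for the all-ones vector, \<open>l\<close> for the eigenvalue of \<open>u\<close> and \<open>F x = T x - l e\<close>, a monotone
  map that fixes \<open>u\<close>.  If \<open>- I\<close> is closed under reachability in \<^const>\<open>hypergraph_plus\<close>, then
  \<open>F (u - \<delta> e\<^sub>I) \<le> u - \<delta> e\<^sub>I\<close> for all small \<open>\<delta> > 0\<close> (\<open>closed_plus_super\<close>): by additive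
  homogeneity, lowering \<open>u\<close> on \<open>I\<close> is the same as raising it on \<open>- I\<close> up to a constant, and since no
  hyperarc leads from \<open>- I\<close> into \<open>I\<close>, a small raise of this kind leaves the coordinates of the image
  in \<open>I\<close> unchanged.  Dually, if \<open>- J\<close> is closed in \<^const>\<open>hypergraph_minus\<close>, then
  \<open>u + \<delta> e\<^sub>J \<le> F (u + \<delta> e\<^sub>J)\<close> (\<open>closed_minus_sub\<close>), and \<open>u + \<delta> e\<^sub>J - \<delta> e\<close> has the same property.

  If \<open>I\<close> and \<open>J\<close> are disjoint, then \<open>u + \<delta> e\<^sub>J - \<delta> e \<le> u - \<delta> e\<^sub>I\<close>, so the order interval between
  these two vectors is mapped into itself and contains a fixed point by the Knaster--Tarski
  argument.  Both ends of the interval equal \<open>u\<close> on \<open>J\<close> and \<open>u - \<delta>\<close> on \<open>I\<close>, so this fixed point does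
  not differ from \<open>u\<close> by a constant.

  Conversely, let \<open>v\<close> be an eigenvector such that \<open>v - u\<close> is not constant.  Both
  eigenvectors have the same eigenvalue (\<open>eigenvalue_le\<close>), and the sets \<open>I\<close> and \<open>J\<close> where
  \<open>v - u\<close> attains its minimum and its maximum have closed complements
  (\<open>argmin_closed_plus\<close> and \<open>argmax_closed_minus\<close>).

  The statements about \<^const>\<open>hypergraph_minus\<close> are obtained from those about
  \<^const>\<open>hypergraph_plus\<close> by conjugating \<open>T\<close> with \<open>x \<mapsto> - x\<close>.
\<close>

section \<open>Closed sets of nodes and conjugation with negation\<close>

lemma reach_eq_self_iff:
  "reach K H = K \<longleftrightarrow> (\<forall>(t, h) \<in> hyperarcs H. t \<subseteq> K \<longrightarrow> h \<subseteq> K)"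
proof
  assume K: "reach K H = K"
  show "\<forall>(t, h) \<in> hyperarcs H. t \<subseteq> K \<longrightarrow> h \<subseteq> K"
    using reach.step[where I = K and H = H] unfolding K by blast
next
  assume closed: "\<forall>(t, h) \<in> hyperarcs H. t \<subseteq> K \<longrightarrow> h \<subseteq> K"
  have "j \<in> K" if "j \<in> reach K H" for j
    using that by induction (use closed in blast)+
  then show "reach K H = K"
    by (auto intro: reach.start)
qed

definition neg_conj :: "(real ^ 'n \<Rightarrow> real ^ 'n) \<Rightarrow> real ^ 'n \<Rightarrow> real ^ 'n" where
  "neg_conj T x = - T (- x)"

lemma mono_neg_conj: "mono T \<Longrightarrow> mono (neg_conj T)"
  by (simp add: mono_def neg_conj_def)

lemma additively_homogeneous_add:
  "additively_homogeneous T \<Longrightarrow> T (x + \<alpha> *\<^sub>R all_ones) = T x + \<alpha> *\<^sub>R all_ones"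
  by (simp add: additively_homogeneous_def)

lemma additively_homogeneous_neg_conj:
  assumes "additively_homogeneous T"
  shows "additively_homogeneous (neg_conj T)"
  unfolding additively_homogeneous_def neg_conj_def
proof (intro allI)
  fix \<alpha> :: real and x :: "real ^ 'a"
  show "- T (- (x + \<alpha> *\<^sub>R all_ones)) = - T (- x) + \<alpha> *\<^sub>R all_ones"
    using additively_homogeneous_add[OF assms, of "- x" "- \<alpha>"] by simp
qed

lemma hypergraph_minus_eq_plus_neg_conj:
  "hypergraph_minus T u = hypergraph_plus (neg_conj T) (- u)"
proof -
  have "- (- u + \<epsilon> *\<^sub>R ind_vec J) = u - \<epsilon> *\<^sub>R ind_vec J" for \<epsilon> J
    by simp
  then show ?thesis
    by (simp add: hypergraph_minus_def hypergraph_plus_def neg_conj_def)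
qed

section \<open>Closed sets yield sub- and super-eigenvectors\<close>

text \<open>
  For each \<open>i \<in> I\<close> the pair \<open>(- I, {i})\<close> is not a hyperarc, which gives some \<open>\<epsilon>\<^sub>i > 0\<close> for which
  raising \<open>u\<close> by \<open>\<epsilon>\<^sub>i\<close> on \<open>- I\<close> does not increase coordinate \<open>i\<close>.  The minimum of these
  finitely many thresholds works for all of \<open>I\<close>.  On \<open>- I\<close> the bound is monotonicity alone.
\<close>

lemma closed_plus_super:
  fixes T :: "real ^ 'n \<Rightarrow> real ^ 'n"
  assumes "mono T" and "additively_homogeneous T"
    and closed: "reach (- I) (hypergraph_plus T u) = - I"
  shows "\<exists>\<epsilon>>0. \<forall>\<delta>. 0 \<le> \<delta> \<and> \<delta> \<le> \<epsilon> \<longrightarrow>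
           T (u - \<delta> *\<^sub>R ind_vec I) \<le> T u - \<delta> *\<^sub>R ind_vec I"
proof -
  have "\<exists>\<epsilon>>0. T (u + \<epsilon> *\<^sub>R ind_vec (- I)) $ i \<le> T u $ i" if "i \<in> I" for i
  proof (rule ccontr)
    assume "\<not> ?thesis"
    then have "(- I, {i}) \<in> hyperarcs (hypergraph_plus T u)"
      using that by (auto simp: hypergraph_plus_def not_le)
    with closed that show False
      unfolding reach_eq_self_iff by blast
  qed
  then obtain f where f: "\<And>i. i \<in> I \<Longrightarrow> f i > 0"
      "\<And>i. i \<in> I \<Longrightarrow> T (u + f i *\<^sub>R ind_vec (- I)) $ i \<le> T u $ i"
    by metis
  \<comment> \<open>The extra element 1 keeps the minimum meaningful when \<open>I\<close> is empty.\<close>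
  define \<epsilon> where "\<epsilon> = Min (insert 1 (f ` I))"
  have pos: "\<epsilon> > 0"
    using f(1) by (simp add: \<epsilon>_def)
  have le: "\<epsilon> \<le> f i" if "i \<in> I" for i
    using that by (simp add: \<epsilon>_def)
  have "T (u - \<delta> *\<^sub>R ind_vec I) \<le> T u - \<delta> *\<^sub>R ind_vec I" if \<delta>: "0 \<le> \<delta>" "\<delta> \<le> \<epsilon>" for \<delta>
    unfolding less_eq_vec_def
  proof
    fix i
    have shift: "u - \<delta> *\<^sub>R ind_vec I = (u + \<delta> *\<^sub>R ind_vec (- I)) + (- \<delta>) *\<^sub>R all_ones"
      by (simp add: vec_eq_iff ind_vec_def all_ones_def)
    show "T (u - \<delta> *\<^sub>R ind_vec I) $ i \<le> (T u - \<delta> *\<^sub>R ind_vec I) $ i"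
    proof (cases "i \<in> I")
      case True
      have "u + \<delta> *\<^sub>R ind_vec (- I) \<le> u + f i *\<^sub>R ind_vec (- I)"
        using \<delta> le[OF True] by (simp add: less_eq_vec_def ind_vec_def)
      then have "T (u + \<delta> *\<^sub>R ind_vec (- I)) \<le> T (u + f i *\<^sub>R ind_vec (- I))"
        by (rule monoD[OF \<open>mono T\<close>])
      then have "T (u + \<delta> *\<^sub>R ind_vec (- I)) $ i \<le> T (u + f i *\<^sub>R ind_vec (- I)) $ i"
        unfolding less_eq_vec_def ..
      also have "\<dots> \<le> T u $ i" by (rule f(2)[OF True])
      finally have "T (u + \<delta> *\<^sub>R ind_vec (- I)) $ i \<le> T u $ i" .
      then show ?thesis
        unfolding shift additively_homogeneous_add[OF assms(2)]
        using True by (simp add: all_ones_def ind_vec_def)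
    next
      case False
      have "u - \<delta> *\<^sub>R ind_vec I \<le> u"
        using \<delta> by (simp add: less_eq_vec_def ind_vec_def)
      then have "T (u - \<delta> *\<^sub>R ind_vec I) \<le> T u"
        by (rule monoD[OF \<open>mono T\<close>])
      then have "T (u - \<delta> *\<^sub>R ind_vec I) $ i \<le> T u $ i"
        unfolding less_eq_vec_def ..
      then show ?thesis
        using False by (simp add: ind_vec_def)
    qed
  qed
  with pos show ?thesis by blast
qed

lemma closed_minus_sub:
  fixes T :: "real ^ 'n \<Rightarrow> real ^ 'n"
  assumes "mono T" and "additively_homogeneous T"
    and "reach (- J) (hypergraph_minus T u) = - J"
  shows "\<exists>\<epsilon>>0. \<forall>\<delta>. 0 \<le> \<delta> \<and> \<delta> \<le> \<epsilon> \<longrightarrow>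
           T u + \<delta> *\<^sub>R ind_vec J \<le> T (u + \<delta> *\<^sub>R ind_vec J)"
proof -
  have neg: "neg_conj T (- u - x) \<le> neg_conj T (- u) - x \<longleftrightarrow> T u + x \<le> T (u + x)" for x
  proof -
    have "- p \<le> - q - r \<longleftrightarrow> q + r \<le> p" for p q r :: real
      by linarith
    then show ?thesis
      by (simp add: neg_conj_def less_eq_vec_def add.commute[of x u])
  qed
  show ?thesis
    using closed_plus_super[OF mono_neg_conj[OF assms(1)]
        additively_homogeneous_neg_conj[OF assms(2)], of J "- u"] assms(3)
    by (simp only: hypergraph_minus_eq_plus_neg_conj neg)
qed

text \<open>
  The Knaster--Tarski argument inside an order interval: the supremum of the elements below their
  image is fixed.
\<close>

lemma mono_fixpoint_in_interval:
  fixes F :: "'a::conditionally_complete_lattice \<Rightarrow> 'a"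
  assumes "mono F" "a \<le> b" "a \<le> F a" "F b \<le> b"
  obtains x where "a \<le> x" "x \<le> b" "F x = x"
proof
  define S where "S = {x. a \<le> x \<and> x \<le> b \<and> x \<le> F x}"
  have "a \<in> S" using assms by (simp add: S_def)
  have bdd: "bdd_above S" by (auto simp: S_def intro: bdd_aboveI[of _ b])
  have upper: "x \<le> Sup S" if "x \<in> S" for x
    using that bdd by (rule cSup_upper)
  show "a \<le> Sup S" by (rule upper) fact
  show "Sup S \<le> b" using \<open>a \<in> S\<close> by (intro cSup_least) (auto simp: S_def)
  have post: "Sup S \<le> F (Sup S)"
  proof (rule cSup_least)
    show "S \<noteq> {}" using \<open>a \<in> S\<close> by blast
    fix x assume "x \<in> S"
    then have "x \<le> F x" by (simp add: S_def)
    also have "\<dots> \<le> F (Sup S)" using upper[OF \<open>x \<in> S\<close>] by (rule monoD[OF \<open>mono F\<close>])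
    finally show "x \<le> F (Sup S)" .
  qed
  have "F (Sup S) \<le> F b" using \<open>Sup S \<le> b\<close> by (rule monoD[OF \<open>mono F\<close>])
  then have "F (Sup S) \<in> S"
    using post \<open>a \<le> Sup S\<close> \<open>F b \<le> b\<close> monoD[OF \<open>mono F\<close> post] by (auto simp: S_def)
  from upper[OF this] post show "F (Sup S) = Sup S" by (rule order.antisym)
qed

section \<open>Comparing two eigenvectors\<close>

text \<open>
  Shift \<open>u\<close> by the minimum of \<open>v - u\<close>, so that it touches \<open>v\<close> from below.  At a contact point
  monotonicity compares the eigenvalues.
\<close>

lemma eigenvalue_le:
  fixes T :: "real ^ 'n \<Rightarrow> real ^ 'n"
  assumes "mono T" and "additively_homogeneous T"
    and u: "T u = l *\<^sub>R all_ones + u" and v: "T v = m *\<^sub>R all_ones + v"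
  shows "l \<le> m"
proof -
  obtain i where i: "\<And>j. v $ i - u $ i \<le> v $ j - u $ j"
    using ex_is_arg_min_if_finite[of UNIV "\<lambda>i. v $ i - u $ i"]
    by (auto simp: is_arg_min_linorder)
  have "u + (v $ i - u $ i) *\<^sub>R all_ones \<le> v"
    using i by (simp add: less_eq_vec_def all_ones_def le_diff_eq add.commute)
  from monoD[OF \<open>mono T\<close> this]
  have "T u + (v $ i - u $ i) *\<^sub>R all_ones \<le> T v"
    by (simp only: additively_homogeneous_add[OF assms(2)])
  then have "(T u + (v $ i - u $ i) *\<^sub>R all_ones) $ i \<le> T v $ i"
    unfolding less_eq_vec_def ..
  then show ?thesis
    by (simp add: u v all_ones_def)
qed

text \<open>
  A hyperarc \<open>(K, {i})\<close> that enters the argmin set \<open>I\<close> from outside is impossible: with \<open>c\<close> the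
  minimum of \<open>v - u\<close>, some \<open>\<epsilon> > 0\<close> satisfies \<open>u + c e + \<epsilon> e\<^sub>K \<le> v\<close>, hence
  \<open>T v $ i \<ge> T (u + \<epsilon> e\<^sub>K) $ i + c > T u $ i + c\<close>, although equality of the eigenvalues forces
  \<open>T v $ i = T u $ i + c\<close>.
\<close>

lemma argmin_closed_plus:
  fixes T :: "real ^ 'n \<Rightarrow> real ^ 'n"
  assumes "mono T" and "additively_homogeneous T"
    and u: "T u = l *\<^sub>R all_ones + u" and v: "T v = l *\<^sub>R all_ones + v"
  defines "I \<equiv> {i. \<forall>j. v $ i - u $ i \<le> v $ j - u $ j}"
  shows "reach (- I) (hypergraph_plus T u) = - I"
proof -
  have False if i: "i \<in> I" and K: "K \<subseteq> - I"
    and arc: "\<forall>\<epsilon>>0. T (u + \<epsilon> *\<^sub>R ind_vec K) $ i > T u $ i" for i K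
  proof -
    define c where "c = v $ i - u $ i"
    have c_le: "c \<le> v $ j - u $ j" for j
      using i by (simp add: I_def c_def)
    have c_less: "c < v $ k - u $ k" if "k \<in> K" for k
    proof (rule ccontr)
      assume "\<not> ?thesis"
      then have "v $ k - u $ k \<le> c" by simp
      then have "v $ k - u $ k \<le> v $ j - u $ j" for j
        using c_le[of j] by (rule order_trans)
      then have "k \<in> I" by (simp add: I_def)
      with that K show False by blast
    qed
    define \<epsilon> where "\<epsilon> = Min (insert 1 ((\<lambda>k. v $ k - u $ k - c) ` K))"
    have pos: "\<epsilon> > 0"
      using c_less by (simp add: \<epsilon>_def)
    have le: "\<epsilon> \<le> v $ k - u $ k - c" if "k \<in> K" for k
      unfolding \<epsilon>_def by (rule Min_le) (use that in auto)
    have "u + \<epsilon> *\<^sub>R ind_vec K + c *\<^sub>R all_ones \<le> v"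
      unfolding less_eq_vec_def
    proof
      fix j
      show "(u + \<epsilon> *\<^sub>R ind_vec K + c *\<^sub>R all_ones) $ j \<le> v $ j"
        using le[of j] c_le[of j] by (cases "j \<in> K") (simp_all add: ind_vec_def all_ones_def)
    qed
    from monoD[OF \<open>mono T\<close> this]
    have "T (u + \<epsilon> *\<^sub>R ind_vec K) + c *\<^sub>R all_ones \<le> T v"
      by (simp only: additively_homogeneous_add[OF assms(2)])
    then have "(T (u + \<epsilon> *\<^sub>R ind_vec K) + c *\<^sub>R all_ones) $ i \<le> T v $ i"
      unfolding less_eq_vec_def ..
    then have "T (u + \<epsilon> *\<^sub>R ind_vec K) $ i \<le> T u $ i"
      by (simp add: u v all_ones_def c_def)
    with arc pos show False by (auto simp: not_le[symmetric])
  qed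
  then show ?thesis
    unfolding reach_eq_self_iff hypergraph_plus_def by auto
qed

lemma argmax_closed_minus:
  fixes T :: "real ^ 'n \<Rightarrow> real ^ 'n"
  assumes "mono T" and "additively_homogeneous T"
    and u: "T u = l *\<^sub>R all_ones + u" and v: "T v = l *\<^sub>R all_ones + v"
  defines "J \<equiv> {i. \<forall>j. v $ j - u $ j \<le> v $ i - u $ i}"
  shows "reach (- J) (hypergraph_minus T u) = - J"
proof -
  have "J = {i. \<forall>j. (- v) $ i - (- u) $ i \<le> (- v) $ j - (- u) $ j}"
    by (auto simp: J_def algebra_simps)
  moreover have "neg_conj T (- u) = (- l) *\<^sub>R all_ones + - u"
      "neg_conj T (- v) = (- l) *\<^sub>R all_ones + - v"
    by (simp_all add: neg_conj_def u v)
  ultimately show ?thesis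
    using argmin_closed_plus[OF mono_neg_conj additively_homogeneous_neg_conj] assms(1,2)
    by (simp only: hypergraph_minus_eq_plus_neg_conj)
qed

section \<open>Characterisation of uniqueness\<close>

theorem theorem4p8:
  fixes T :: "real ^ 'n \<Rightarrow> real ^ 'n" and u :: "real ^ 'n"
  assumes "mono T"
    and "additively_homogeneous T"
    and "add_eigenvector T u"
  shows "\<not> unique_up_to_constant T u \<longleftrightarrow>
    (\<exists>I J. I \<noteq> {} \<and> J \<noteq> {} \<and> I \<inter> J = {} \<and>
       reach (- I) (hypergraph_plus T u) = - I \<and>
       reach (- J) (hypergraph_minus T u) = - J)"
proof -
  obtain l where u: "T u = l *\<^sub>R all_ones + u"
    using assms(3) by (auto simp: add_eigenvector_def)
  show ?thesis
  proof
    assume "\<not> unique_up_to_constant T u"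
    then obtain v m where v: "T v = m *\<^sub>R all_ones + v" and nonconst: "\<And>c. v \<noteq> u + c *\<^sub>R all_ones"
      by (auto simp: unique_up_to_constant_def add_eigenvector_def)
    have "m = l"
      using eigenvalue_le[OF assms(1,2) u v] eigenvalue_le[OF assms(1,2) v u] by simp
    define I where "I = {i. \<forall>j. v $ i - u $ i \<le> v $ j - u $ j}"
    define J where "J = {i. \<forall>j. v $ j - u $ j \<le> v $ i - u $ i}"
    have "I \<noteq> {}"
      using ex_is_arg_min_if_finite[of UNIV "\<lambda>i. v $ i - u $ i"]
      by (auto simp: I_def is_arg_min_linorder)
    moreover have "J \<noteq> {}"
      using ex_is_arg_min_if_finite[of UNIV "\<lambda>i. u $ i - v $ i"]
      by (auto simp: J_def is_arg_min_linorder algebra_simps)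
    moreover have "I \<inter> J = {}"
    proof (rule ccontr)
      assume "I \<inter> J \<noteq> {}"
      then obtain i where "i \<in> I" "i \<in> J" by blast
      then have const: "v $ j - u $ j = v $ i - u $ i" for j
        unfolding I_def J_def by (blast intro: order.antisym)
      have "v $ j = u $ j + (v $ i - u $ i)" for j
        using const[of j] by linarith
      then have "v = u + (v $ i - u $ i) *\<^sub>R all_ones"
        unfolding vec_eq_iff all_ones_def
        by (metis mult.right_neutral real_scaleR_def vec_lambda_beta vector_add_component
            vector_scaleR_component)
      with nonconst show False by blast
    qed
    moreover have "reach (- I) (hypergraph_plus T u) = - I"
      unfolding I_def by (rule argmin_closed_plus[OF assms(1,2) u v[unfolded \<open>m = l\<close>]])
    moreover have "reach (- J) (hypergraph_minus T u) = - J"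
      unfolding J_def by (rule argmax_closed_minus[OF assms(1,2) u v[unfolded \<open>m = l\<close>]])
    ultimately show "\<exists>I J. I \<noteq> {} \<and> J \<noteq> {} \<and> I \<inter> J = {} \<and>
       reach (- I) (hypergraph_plus T u) = - I \<and> reach (- J) (hypergraph_minus T u) = - J"
      by blast
  next
    assume "\<exists>I J. I \<noteq> {} \<and> J \<noteq> {} \<and> I \<inter> J = {} \<and>
       reach (- I) (hypergraph_plus T u) = - I \<and> reach (- J) (hypergraph_minus T u) = - J"
    then obtain I J i j where i: "i \<in> I" and j: "j \<in> J" and disj: "I \<inter> J = {}"
      and I: "reach (- I) (hypergraph_plus T u) = - I"
      and J: "reach (- J) (hypergraph_minus T u) = - J"
      by blast
    obtain \<epsilon>1 where \<epsilon>1: "\<epsilon>1 > 0" "\<And>\<delta>. 0 \<le> \<delta> \<Longrightarrow> \<delta> \<le> \<epsilon>1 \<Longrightarrow>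
        T (u - \<delta> *\<^sub>R ind_vec I) \<le> T u - \<delta> *\<^sub>R ind_vec I"
      using closed_plus_super[OF assms(1,2) I] by blast
    obtain \<epsilon>2 where \<epsilon>2: "\<epsilon>2 > 0" "\<And>\<delta>. 0 \<le> \<delta> \<Longrightarrow> \<delta> \<le> \<epsilon>2 \<Longrightarrow>
        T u + \<delta> *\<^sub>R ind_vec J \<le> T (u + \<delta> *\<^sub>R ind_vec J)"
      using closed_minus_sub[OF assms(1,2) J] by blast
    define \<delta> where "\<delta> = min \<epsilon>1 \<epsilon>2"
    have \<delta>: "\<delta> > 0" "0 \<le> \<delta>" "\<delta> \<le> \<epsilon>1" "\<delta> \<le> \<epsilon>2"
      using \<epsilon>1(1) \<epsilon>2(1) by (auto simp: \<delta>_def)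
    define F where "F x = T x - l *\<^sub>R all_ones" for x
    define a where "a = u + \<delta> *\<^sub>R ind_vec J + (- \<delta>) *\<^sub>R all_ones"
    define b where "b = u - \<delta> *\<^sub>R ind_vec I"
    have "mono F"
      using \<open>mono T\<close> by (simp add: mono_def F_def)
    moreover have "a \<le> b"
      unfolding less_eq_vec_def
    proof
      fix k
      show "a $ k \<le> b $ k"
        using disj \<delta>(2) by (auto simp: a_def b_def ind_vec_def all_ones_def)
    qed
    moreover have "a \<le> F a"
      using \<epsilon>2(2)[OF \<delta>(2,4)]
      unfolding F_def a_def additively_homogeneous_add[OF assms(2)]
      by (simp add: u less_eq_vec_def algebra_simps)
    moreover have "F b \<le> b"
      using \<epsilon>1(2)[OF \<delta>(2,3)] unfolding F_def b_def
      by (simp add: u less_eq_vec_def algebra_simps)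
    ultimately obtain x where x: "a \<le> x" "x \<le> b" "F x = x"
      by (rule mono_fixpoint_in_interval)
    from x(3) have "add_eigenvector T x"
      unfolding add_eigenvector_def F_def by (intro exI[of _ l]) (simp add: algebra_simps)
    have bounds: "a $ k \<le> x $ k" "x $ k \<le> b $ k" for k
      using x(1,2) by (simp_all add: less_eq_vec_def)
    \<comment> \<open>The two ends of the interval coincide on \<open>I\<close> and on \<open>J\<close>.\<close>
    have "i \<notin> J" "j \<notin> I"
      using i j disj by auto
    then have "x $ i = u $ i - \<delta>" "x $ j = u $ j"
      using bounds[of i] bounds[of j] i j by (simp_all add: a_def b_def ind_vec_def all_ones_def)
    then have "x \<noteq> u + c *\<^sub>R all_ones" for c
      using \<delta>(1) by (auto simp: all_ones_def)
    with \<open>add_eigenvector T x\<close> show "\<not> unique_up_to_constant T u"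
      by (auto simp: unique_up_to_constant_def)
  qed
qed

end
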